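(* Assume $\frac{dF}{dt}\neq0$ and $V_mV_m^T\frac{dF}{dt}\neq0$, where $\frac{dF}{dt}=\frac{dF}{dt}(t_n,u_n)$. Let $E_{S_1}$ be the local error using the ETD1 Krylov recycling scheme over a timestep of length $\Delta t$ with $S_1\ge1$ substeps, and $E_{S_2}$ the local error with $S_2$ substeps, where $S_2>S_1$. Then $$\|E_{S_2}\|_2<\|E_{S_1}\|_2 .$$
   Context: Let $L\in\mathbb{R}^{N\times N}$ and consider the semilinear ODE system $\frac{du}{dt}=Lu+F(t,u(t))$ with $u(t),F(t,u(t))\in\mathbb{R}^N$. Local errors are taken under the assumption $u_n=u(t_n)$. Put $g_n=Lu_n+F(t_n,u_n)$ and $\frac{dF}{dt}(t_n,u_n)=\frac{\partial F}{\partial t}(t_n,u_n)+\frac{\partial F}{\partial u}(t_n,u_n)g_n$. $\|\cdot\|_2$ is the Euclidean norm. The Arnoldi algorithm applied to $L$ and $g_n$ gives $V_m\in\mathbb{R}^{N\times m}$, whose columns are an orthonormal basis of the Krylov subspace $\mathcal{K}_m(L,g_n)=\mathrm{span}\{g_n,Lg_n,\dots,L^{m-1}g_n\}$, and the upper Hessenberg matrix $H_m=V_m^TLV_m\in\mathbb{R}^{m\times m}$. Thus $V_mV_m^T$ is the orthogonal projector onto $\mathcal{K}_m(L,g_n)$. Let $\varphi_1(z)=\sum_{k\ge0}z^k/(k+1)!$, $p_\tau=\tau\varphi_1(\tau L)$ and $\tilde p_\tau=\tau V_m\varphi_1(\tau H_m)V_m^T$. The ETD1 Krylov recycling scheme with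 $S\ge1$ substeps of length $\delta t=\Delta t/S$ is $$u_{n+\frac1S}=u_n+\tilde p_{\delta t}g_n,\qquad u_{n+\frac jS}=u_{n+\frac{j-1}S}+\tilde p_{\delta t}\left(Lu_{n+\frac{j-1}S}+F\left(t_n+(j-1)\delta t,u_{n+\frac{j-1}S}\right)\right),\quad 1<j\le S,$$ with the same $V_m,H_m$ used in all substeps. The approximation to $u(t_n+\Delta t)$ is $u_{n+1}=u_{n+\frac SS}$. The local error with $S$ substeps is $E_S=u(t_n+\Delta t)-u_{n+1}$, and it has the form $E_S=\frac{\Delta t^2}{2}\left(I-\frac{S-1}{S}V_mV_m^T\right)\frac{dF}{dt}(t_n,u_n)+O(\Delta t^3)$. Standing assumption: the Krylov approximation error $\tilde p_\tau g_n-p_\tau g_n$ over a single step is much less than the error of the ETD1 scheme $u_{n+1}=u_n+p_{\Delta t}g_n$, and so does not affect the leading term of the local error of ETD1.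
   Formalization: The inequality is proved for all sufficiently small Δt > 0 (threshold may depend on the problem, S_1 and S_2), since it can fail for large Δt; "much less" for the Krylov error is read as little-o of the ETD1 error as the step tends to 0. *)

theory Defs
  imports "HOL-Analysis.Analysis" "HOL-Library.Landau_Symbols"
begin

text \<open>The type \<open>real ^ 'n ^ 'n\<close> carries the componentwise product, so \<open>A ^ k\<close> would be
  the entrywise power. Matrix powers are iterated \<open>**\<close> instead.\<close>

definition matpow :: "real ^ 'n ^ 'n \<Rightarrow> nat \<Rightarrow> real ^ 'n ^ ('n::finite)" where
  "matpow A k = (((**) A) ^^ k) (mat 1)"

definition phi1 :: "real ^ 'n ^ 'n \<Rightarrow> real ^ 'n ^ ('n::finite)" where
  "phi1 A = (\<Sum>k. (1 / fact (k + 1)) *\<^sub>R matpow A k)"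

definition krylov :: "real ^ 'n ^ 'n \<Rightarrow> real ^ 'n \<Rightarrow> nat \<Rightarrow> (real ^ ('n::finite)) set" where
  "krylov L g m = span ((\<lambda>k. matpow L k *v g) ` {..<m})"

definition upper_hessenberg :: "real ^ ('m::{finite,linorder}) ^ ('m::{finite,linorder}) \<Rightarrow> bool" where
  "upper_hessenberg H \<longleftrightarrow> (\<forall>i j k. j < k \<and> k < i \<longrightarrow> H $ i $ j = 0)"

text \<open>The properties of the result \<open>(V, H)\<close> of \<open>m\<close> steps of the Arnoldi algorithm without
  breakdown, where \<open>m = CARD('m)\<close>. The matrix \<open>V\<close> has \<open>CARD('n)\<close> rows and \<open>m\<close> columns; the
  first conjunct says that the columns are orthonormal. The linear order on \<open>'m\<close>
  numbers the basis vectors.\<close>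

definition arnoldi ::
  "real ^ 'n ^ 'n \<Rightarrow> real ^ 'n \<Rightarrow> real ^ ('m::{finite,linorder}) ^ ('n::finite) \<Rightarrow>
   real ^ ('m::{finite,linorder}) ^ ('m::{finite,linorder}) \<Rightarrow> bool" where
  "arnoldi L g V H \<longleftrightarrow>
     transpose V ** V = mat 1 \<and>
     span (columns V) = krylov L g CARD('m) \<and>
     H = transpose V ** L ** V \<and>
     upper_hessenberg H"

definition etd1_op :: "real ^ 'n ^ 'n \<Rightarrow> real \<Rightarrow> real ^ 'n ^ ('n::finite)" where
  "etd1_op L \<tau> = \<tau> *\<^sub>R phi1 (\<tau> *\<^sub>R L)"

definition krylov_op ::
  "real ^ 'm ^ ('n::finite) \<Rightarrow> real ^ 'm ^ ('m::finite) \<Rightarrow> real \<Rightarrow> real ^ 'n ^ 'n" where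
  "krylov_op V H \<tau> = \<tau> *\<^sub>R (V ** phi1 (\<tau> *\<^sub>R H) ** transpose V)"

definition rhs ::
  "real ^ 'n ^ 'n \<Rightarrow> (real \<Rightarrow> real ^ 'n \<Rightarrow> real ^ 'n) \<Rightarrow> real \<Rightarrow> real ^ 'n \<Rightarrow> real ^ ('n::finite)" where
  "rhs L F t x = L *v x + F t x"

text \<open>The derivative of \<open>F\<close> along the flow of \<open>u' = L u + F(t, u)\<close> at \<open>(t, x)\<close>.\<close>

definition dFdt ::
  "real ^ 'n ^ 'n \<Rightarrow> (real \<Rightarrow> real ^ 'n \<Rightarrow> real ^ 'n) \<Rightarrow> real \<Rightarrow> real ^ 'n \<Rightarrow> real ^ ('n::finite)" where
  "dFdt L F t x =
     vector_derivative (\<lambda>s. F s x) (at t) + jacobian (F t) (at x) *v rhs L F t x"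

text \<open>\<open>recycling_substep L F V H tn un \<delta> j\<close> is the approximation after \<open>j\<close> substeps of length
  \<open>\<delta>\<close>. Its first substep adds \<open>krylov_op V H \<delta> *v rhs L F tn un\<close>, so it needs no separate case.\<close>

primrec recycling_substep ::
  "real ^ 'n ^ 'n \<Rightarrow> (real \<Rightarrow> real ^ 'n \<Rightarrow> real ^ 'n) \<Rightarrow>
   real ^ 'm ^ ('n::finite) \<Rightarrow> real ^ 'm ^ ('m::finite) \<Rightarrow>
   real \<Rightarrow> real ^ 'n \<Rightarrow> real \<Rightarrow> nat \<Rightarrow> real ^ 'n" where
  "recycling_substep L F V H tn un \<delta> 0 = un"
| "recycling_substep L F V H tn un \<delta> (Suc j) =
     recycling_substep L F V H tn un \<delta> j +
     krylov_op V H \<delta> *v rhs L F (tn + real j * \<delta>) (recycling_substep L F V H tn un \<delta> j)"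

text \<open>Local errors over one timestep \<open>h\<close> along a solution \<open>u\<close>: both schemes start from the
  exact value \<open>u tn\<close>.\<close>

definition etd1_local_error ::
  "real ^ 'n ^ 'n \<Rightarrow> (real \<Rightarrow> real ^ 'n \<Rightarrow> real ^ 'n) \<Rightarrow> (real \<Rightarrow> real ^ 'n) \<Rightarrow>
   real \<Rightarrow> real \<Rightarrow> real ^ ('n::finite)" where
  "etd1_local_error L F u tn h =
     u (tn + h) - (u tn + etd1_op L h *v rhs L F tn (u tn))"

definition recycling_local_error ::
  "real ^ 'n ^ 'n \<Rightarrow> (real \<Rightarrow> real ^ 'n \<Rightarrow> real ^ 'n) \<Rightarrow>
   real ^ 'm ^ ('n::finite) \<Rightarrow> real ^ 'm ^ ('m::finite) \<Rightarrow>
   (real \<Rightarrow> real ^ 'n) \<Rightarrow> real \<Rightarrow> nat \<Rightarrow> real \<Rightarrow> real ^ 'n" where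
  "recycling_local_error L F V H u tn S h =
     u (tn + h) - recycling_substep L F V H tn (u tn) (h / real S) S"

end

theory Submission
  imports Defs
begin

text \<open>
  Write \<open>g\<close> for the right-hand side at \<open>(tn, u tn)\<close>, \<open>D\<close> for \<open>dF/dt\<close> there, and \<open>P = V V\<^sup>T\<close> for
  the orthogonal projector onto the Krylov space. The theorem follows from the expansion
  \<open>E\<^sub>S(h) = (h\<^sup>2 / 2) (D - ((S - 1) / S) P D) + o(h\<^sup>2)\<close> as \<open>h\<close> tends to \<open>0\<close> from the right
  (\<open>quadratic_expansion_recycling_local_error\<close>). By Pythagoras, the square of
  the norm of \<open>D - c P D\<close> is \<open>|D - P D|\<^sup>2 + (1 - c)\<^sup>2 |P D|\<^sup>2\<close>. For \<open>P D \<noteq> 0\<close> this strictly decreases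
  as \<open>c\<close> grows towards 1, and \<open>c = (S - 1) / S\<close> grows with \<open>S\<close>; a strict inequality between leading
  coefficients is a strict inequality between the errors for all small \<open>h > 0\<close>.

  The expansion compares three quantities. Along the exact solution the right-hand side has
  derivative \<open>L g + D\<close>, so \<open>u (tn + h) = u tn + h g + (h\<^sup>2 / 2) (L g + D) + o(h\<^sup>2)\<close>. One ETD1 step
  gives \<open>u tn + h g + (h\<^sup>2 / 2) L g + o(h\<^sup>2)\<close>, because \<open>\<phi>\<^sub>1(z) = 1 + z / 2 + O(z\<^sup>2)\<close>. The Krylov operator
  is \<open>\<delta> P + (\<delta>\<^sup>2 / 2) V H V\<^sup>T + o(\<delta>\<^sup>2)\<close>, with \<open>P g = g\<close>, so after \<open>S\<close> substeps of length \<open>\<delta>\<close> the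
  scheme is at \<open>u tn + S \<delta> g + (S\<^sup>2 \<delta>\<^sup>2 / 2) L g + (S (S - 1) \<delta>\<^sup>2 / 2) P D + o(\<delta>\<^sup>2)\<close>, provided that
  \<open>V H V\<^sup>T g = P L g\<close> equals \<open>L g\<close>. That identity is where the standing assumption enters:
  the ETD1 error is \<open>O(h\<^sup>2)\<close>, so a Krylov error of smaller order forces the quadratic coefficients of
  the Krylov and the exact ETD1 step to agree (\<open>krylov_coefficients_of_small_error\<close>).
\<close>

section \<open>One-sided second-order expansions\<close>

text \<open>A Peano expansion \<open>f h = f 0 + h b + h\<^sup>2 c + o(h\<^sup>2)\<close> for \<open>h\<close> decreasing to \<open>0\<close>. It is weaker than
  twofold differentiability, which would be too much to ask: where \<open>F\<close> is differentiable at a single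
  point, neither the exact solution nor the numerical one need have a second derivative nearby. The coefficient \<open>c\<close>
  is half of a second derivative.\<close>

definition quadratic_expansion ::
  "(real \<Rightarrow> 'a::real_normed_vector) \<Rightarrow> 'a \<Rightarrow> 'a \<Rightarrow> bool" where
  "quadratic_expansion f b c \<longleftrightarrow>
     ((\<lambda>h. (f h - f 0 - h *\<^sub>R b) /\<^sub>R h\<^sup>2) \<longlongrightarrow> c) (at_right 0)"

lemma has_vector_derivative_at_right_0_iff:
  "(f has_vector_derivative b) (at_right 0) \<longleftrightarrow>
     ((\<lambda>h. (f h - f 0) /\<^sub>R h) \<longlongrightarrow> b) (at_right 0)"
proof -
  have "(f has_vector_derivative b) (at_right 0) \<longleftrightarrow>
      ((\<lambda>h. ((f h - f 0) - h *\<^sub>R b) /\<^sub>R norm h) \<longlongrightarrow> 0) (at_right 0)"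
    unfolding has_vector_derivative_def
    by (simp add: has_derivative_at_within bounded_linear_scaleR_left)
  also have "\<dots> \<longleftrightarrow> ((\<lambda>h. (f h - f 0) /\<^sub>R h - b) \<longlongrightarrow> 0) (at_right 0)"
    by (rule filterlim_cong[OF refl refl])
      (auto simp: eventually_at_right_less scaleR_diff_right intro!: eventually_at_rightI[of 0 1])
  finally show ?thesis by (simp add: LIM_zero_iff)
qed

lemma quadratic_expansion_imp_derivative:
  assumes "quadratic_expansion f b c"
  shows "(f has_vector_derivative b) (at_right 0)"
proof -
  have "((\<lambda>h. h *\<^sub>R ((f h - f 0 - h *\<^sub>R b) /\<^sub>R h\<^sup>2) + b) \<longlongrightarrow> 0 *\<^sub>R c + b) (at_right 0)"
    using assms unfolding quadratic_expansion_def by (intro tendsto_intros)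
  also have "?this \<longleftrightarrow> ((\<lambda>h. (f h - f 0) /\<^sub>R h) \<longlongrightarrow> b) (at_right 0)"
    by (intro filterlim_cong eventually_at_rightI[of 0 1])
      (auto simp: power2_eq_square scaleR_diff_right field_simps)
  finally show ?thesis by (simp add: has_vector_derivative_at_right_0_iff)
qed

lemma quadratic_expansion_add:
  assumes "quadratic_expansion f b c" "quadratic_expansion f' b' c'"
  shows "quadratic_expansion (\<lambda>h. f h + f' h) (b + b') (c + c')"
  using tendsto_add[OF assms[unfolded quadratic_expansion_def]]
  unfolding quadratic_expansion_def by (simp add: algebra_simps)

lemma quadratic_expansion_diff:
  assumes "quadratic_expansion f b c" "quadratic_expansion f' b' c'"
  shows "quadratic_expansion (\<lambda>h. f h - f' h) (b - b') (c - c')"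
  using tendsto_diff[OF assms[unfolded quadratic_expansion_def]]
  unfolding quadratic_expansion_def by (simp add: algebra_simps)

lemma quadratic_expansion_rescale:
  assumes "quadratic_expansion f b c" and "s > 0"
  shows "quadratic_expansion (\<lambda>h. f (s * h)) (s *\<^sub>R b) (s\<^sup>2 *\<^sub>R c)"
proof -
  have "filterlim ((*) s) (at_right 0) (at_right 0)"
    using filterlim_times_pos[OF filterlim_ident \<open>s > 0\<close>, of 0 0] by simp
  from filterlim_compose[OF assms(1)[unfolded quadratic_expansion_def] this]
  have "((\<lambda>h. s\<^sup>2 *\<^sub>R ((f (s * h) - f 0 - (s * h) *\<^sub>R b) /\<^sub>R (s * h)\<^sup>2)) \<longlongrightarrow> s\<^sup>2 *\<^sub>R c) (at_right 0)"
    by (intro tendsto_intros)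
  also have "(\<lambda>h. s\<^sup>2 *\<^sub>R ((f (s * h) - f 0 - (s * h) *\<^sub>R b) /\<^sub>R (s * h)\<^sup>2)) =
      (\<lambda>h. (f (s * h) - f (s * 0) - h *\<^sub>R (s *\<^sub>R b)) /\<^sub>R h\<^sup>2)"
    using \<open>s > 0\<close> by (simp add: power_mult_distrib field_simps)
  finally show ?thesis
    by (simp add: quadratic_expansion_def)
qed

text \<open>The factor \<open>\<kappa>\<close> vanishes at \<open>0\<close>, so it supplies one power of \<open>h\<close> and a first-order
  expansion of the other factor suffices. This is what lets the scheme, which multiplies \<open>F\<close> by an
  operator of size \<open>O(h)\<close>, be expanded to second order with \<open>F\<close> only once differentiable.\<close>

lemma quadratic_expansion_bilinear:
  assumes "bounded_bilinear B"
    and "quadratic_expansion \<kappa> b c" and "\<kappa> 0 = 0"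
    and "(r has_vector_derivative r') (at_right 0)"
  shows "quadratic_expansion (\<lambda>h. B (\<kappa> h) (r h)) (B b (r 0)) (B c (r 0) + B b r')"
proof -
  interpret bounded_bilinear B by fact
  have quot: "((\<lambda>h. (r h - r 0) /\<^sub>R h) \<longlongrightarrow> r') (at_right 0)"
    using assms(4) by (simp add: has_vector_derivative_at_right_0_iff)
  have "((\<lambda>h. h *\<^sub>R ((r h - r 0) /\<^sub>R h) + r 0) \<longlongrightarrow> 0 *\<^sub>R r' + r 0) (at_right 0)"
    by (intro tendsto_intros quot)
  also have "?this \<longleftrightarrow> (r \<longlongrightarrow> r 0) (at_right 0)"
    by (rule filterlim_cong) (auto intro!: eventually_at_rightI[of 0 1])
  finally have cont: "(r \<longlongrightarrow> r 0) (at_right 0)" .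
  have "((\<lambda>h. B ((\<kappa> h - \<kappa> 0 - h *\<^sub>R b) /\<^sub>R h\<^sup>2) (r h) + B b ((r h - r 0) /\<^sub>R h))
      \<longlongrightarrow> B c (r 0) + B b r') (at_right 0)"
    using assms(2) unfolding quadratic_expansion_def by (intro tendsto_add tendsto cont quot tendsto_const)
  also have "?this \<longleftrightarrow> ((\<lambda>h. (B (\<kappa> h) (r h) - h *\<^sub>R B b (r 0)) /\<^sub>R h\<^sup>2)
      \<longlongrightarrow> B c (r 0) + B b r') (at_right 0)"
    using \<open>\<kappa> 0 = 0\<close>
    by (intro filterlim_cong)
      (auto intro!: eventually_at_rightI[of 0 1]
        simp: power2_eq_square diff_left diff_right scaleR_left scaleR_right scaleR_diff_right field_simps)
  finally show ?thesis
    using \<open>\<kappa> 0 = 0\<close> by (simp add: quadratic_expansion_def zero_left)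
qed

text \<open>After division by \<open>h\<^sup>2\<close> both norms converge, to strictly ordered limits.\<close>

lemma norm_less_of_quadratic_expansion:
  assumes "quadratic_expansion e1 0 c1" "e1 0 = 0" "quadratic_expansion e2 0 c2" "e2 0 = 0"
    and "norm c1 < norm c2"
  shows "\<forall>\<^sub>F h in at_right 0. norm (e1 h) < norm (e2 h)"
proof -
  have "((\<lambda>h. norm (e2 h /\<^sub>R h\<^sup>2) - norm (e1 h /\<^sub>R h\<^sup>2)) \<longlongrightarrow> norm c2 - norm c1) (at_right 0)"
    using assms(1-4) unfolding quadratic_expansion_def by (intro tendsto_intros) simp_all
  then have "\<forall>\<^sub>F h in at_right 0. 0 < norm (e2 h /\<^sub>R h\<^sup>2) - norm (e1 h /\<^sub>R h\<^sup>2)"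
    using assms(5) by (intro order_tendstoD(1)) auto
  moreover have "\<forall>\<^sub>F h :: real in at_right 0. h > 0"
    by (rule eventually_at_right_less)
  ultimately show ?thesis
    by eventually_elim (simp add: mult_less_cancel_left)
qed

text \<open>Integration gains one order with no regularity of \<open>r\<close> beyond its derivative at \<open>0\<close>: the
  remainder \<open>w\<close> of the expansion has derivative \<open>r t - r 0 - t c\<close>, which is at most \<open>(\<epsilon> / 2) h\<close> on
  \<open>[0, h]\<close> for small \<open>h\<close>, so \<open>w\<close> itself changes by at most \<open>(\<epsilon> / 2) h\<^sup>2\<close> by the mean value
  inequality.\<close>

lemma quadratic_expansion_of_primitive:
  fixes x r :: "real \<Rightarrow> 'a::real_normed_vector"
  assumes "T > 0"
    and x': "\<And>t. t \<in> {0..T} \<Longrightarrow> (x has_vector_derivative r t) (at t within {0..T})"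
    and r': "(r has_vector_derivative c) (at_right 0)"
  shows "quadratic_expansion x (r 0) (c /\<^sub>R 2)"
  unfolding quadratic_expansion_def
proof (rule tendstoI)
  fix \<epsilon> :: real assume "\<epsilon> > 0"
  have "\<forall>\<^sub>F t in at_right 0. dist ((r t - r 0) /\<^sub>R t) c < \<epsilon> / 2"
    using r' \<open>\<epsilon> > 0\<close> by (intro tendstoD) (auto simp: has_vector_derivative_at_right_0_iff)
  then obtain d where "d > 0"
    and d: "\<And>t. 0 < t \<Longrightarrow> t < d \<Longrightarrow> dist ((r t - r 0) /\<^sub>R t) c < \<epsilon> / 2"
    by (auto simp: eventually_at_right_field)
  have r_close: "norm (r t - r 0 - t *\<^sub>R c) \<le> \<epsilon> / 2 * t" if "0 \<le> t" "t < d" for t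
  proof (cases "t = 0")
    case False
    then have "r t - r 0 - t *\<^sub>R c = t *\<^sub>R ((r t - r 0) /\<^sub>R t - c)"
      by (simp add: scaleR_diff_right)
    then have "norm (r t - r 0 - t *\<^sub>R c) = t * dist ((r t - r 0) /\<^sub>R t) c"
      using \<open>0 \<le> t\<close> by (simp add: dist_norm)
    also have "\<dots> \<le> t * (\<epsilon> / 2)"
      using d[of t] that False by (intro mult_left_mono) auto
    finally show ?thesis by (simp add: mult.commute)
  qed simp
  define w where "w t = x t - t *\<^sub>R r 0 - (t\<^sup>2 / 2) *\<^sub>R c" for t
  have "dist ((x h - x 0 - h *\<^sub>R r 0) /\<^sub>R h\<^sup>2) (c /\<^sub>R 2) < \<epsilon>" if "0 < h" "h < min d T" for h
  proof -
    have "norm (w h - w 0) \<le> (\<epsilon> / 2 * h) * norm (h - 0)"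
    proof (rule differentiable_bound[where S = "{0..h}"])
      fix t assume t: "t \<in> {0..h}"
      have "(x has_vector_derivative r t) (at t within {0..h})"
        using x'[of t] t that by (auto intro: has_vector_derivative_within_subset)
      then have "(w has_vector_derivative (r t - r 0 - t *\<^sub>R c)) (at t within {0..h})"
        unfolding w_def
        by (auto intro!: derivative_eq_intros simp: has_vector_derivative_def algebra_simps)
      then show "(w has_derivative (\<lambda>s. s *\<^sub>R (r t - r 0 - t *\<^sub>R c))) (at t within {0..h})"
        by (simp add: has_vector_derivative_def)
      have "norm (r t - r 0 - t *\<^sub>R c) \<le> \<epsilon> / 2 * h"
        by (rule order_trans[OF r_close[of t]]) (use t that \<open>\<epsilon> > 0\<close> in \<open>auto intro: mult_left_mono\<close>)
      from mult_right_mono[OF this abs_ge_zero]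
      show "onorm (\<lambda>s. s *\<^sub>R (r t - r 0 - t *\<^sub>R c)) \<le> \<epsilon> / 2 * h"
        by (intro onorm_le) (simp only: norm_scaleR real_norm_def mult.commute)
    qed (use that in auto)
    also have "w h - w 0 = h\<^sup>2 *\<^sub>R ((x h - x 0 - h *\<^sub>R r 0) /\<^sub>R h\<^sup>2 - c /\<^sub>R 2)"
      using \<open>0 < h\<close> by (simp add: w_def algebra_simps)
    finally have "norm (h\<^sup>2 *\<^sub>R ((x h - x 0 - h *\<^sub>R r 0) /\<^sub>R h\<^sup>2 - c /\<^sub>R 2)) \<le> (\<epsilon> / 2 * h) * norm (h - 0)" .
    then have "h\<^sup>2 * dist ((x h - x 0 - h *\<^sub>R r 0) /\<^sub>R h\<^sup>2) (c /\<^sub>R 2) \<le> h\<^sup>2 * (\<epsilon> / 2)"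
      using \<open>0 < h\<close> unfolding norm_scaleR dist_norm by (simp only: power2_eq_square) (simp add: mult_ac)
    then show ?thesis
      using \<open>0 < h\<close> \<open>\<epsilon> > 0\<close> by simp
  qed
  then show "\<forall>\<^sub>F h in at_right 0. dist ((x h - x 0 - h *\<^sub>R r 0) /\<^sub>R h\<^sup>2) (c /\<^sub>R 2) < \<epsilon>"
    using \<open>d > 0\<close> \<open>T > 0\<close> by (intro eventually_at_rightI[of 0 "min d T"]) auto
qed

section \<open>The function \<open>phi1\<close> and the propagation operators near zero\<close>

text \<open>The terms of order two and higher are \<open>\<tau>\<^sup>2\<close> times a series that is dominated, for
  \<open>0 < \<tau> < 1\<close>, by the sum of the norms of its coefficients.\<close>

lemma power_series_difference_quotient_at_0:
  fixes c :: "nat \<Rightarrow> 'a::banach"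
  assumes "summable (\<lambda>k. norm (c k))"
  shows "((\<lambda>\<tau>. ((\<Sum>k. \<tau> ^ k *\<^sub>R c k) - c 0) /\<^sub>R \<tau>) \<longlongrightarrow> c 1) (at_right 0)"
proof -
  define tail where "tail \<tau> = (\<Sum>k. \<tau> ^ k *\<^sub>R c (k + 2))" for \<tau> :: real
  define M where "M = (\<Sum>k. norm (c (k + 2)))"
  have sM: "summable (\<lambda>k. norm (c (k + 2)))"
    using assms by (rule summable_ignore_initial_segment)
  have bound: "norm (\<tau> ^ k *\<^sub>R c n) \<le> norm (c n)" if "\<tau> \<in> {0<..<1}" for \<tau> :: real and k n
    using that by (auto simp: power_abs intro!: mult_left_le_one_le power_le_one)
  have tail_le: "norm (tail \<tau>) \<le> M" if "\<tau> \<in> {0<..<1}" for \<tau>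
    unfolding tail_def M_def using bound[OF that] sM by (intro norm_suminf_le)
  have split: "((\<Sum>k. \<tau> ^ k *\<^sub>R c k) - c 0) /\<^sub>R \<tau> = c 1 + \<tau> *\<^sub>R tail \<tau>" if "\<tau> \<in> {0<..<1}" for \<tau>
  proof -
    have "summable (\<lambda>k. \<tau> ^ k *\<^sub>R c k)"
      by (rule summable_comparison_test'[OF assms]) (rule bound[OF that])
    from suminf_split_initial_segment[OF this, of 2]
    have "(\<Sum>k. \<tau> ^ k *\<^sub>R c k) = (\<Sum>k. \<tau> ^ (k + 2) *\<^sub>R c (k + 2)) + (c 0 + \<tau> *\<^sub>R c 1)"
      by (simp add: numeral_2_eq_2)
    also have "(\<Sum>k. \<tau> ^ (k + 2) *\<^sub>R c (k + 2)) = (\<Sum>k. \<tau>\<^sup>2 *\<^sub>R (\<tau> ^ k *\<^sub>R c (k + 2)))"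
      by (simp add: power2_eq_square mult_ac)
    also have "\<dots> = \<tau>\<^sup>2 *\<^sub>R tail \<tau>"
      unfolding tail_def
      by (rule suminf_scaleR_right[symmetric], rule summable_comparison_test'[OF sM], rule bound[OF that])
    finally show ?thesis
      using that by (simp add: power2_eq_square scaleR_add_right)
  qed
  have "((\<lambda>\<tau>. \<tau> *\<^sub>R tail \<tau>) \<longlongrightarrow> 0) (at_right 0)"
  proof (rule Lim_null_comparison)
    show "\<forall>\<^sub>F \<tau> in at_right 0. norm (\<tau> *\<^sub>R tail \<tau>) \<le> \<tau> * M"
      using tail_le by (intro eventually_at_rightI[of 0 1]) (auto intro: mult_left_mono)
    show "((\<lambda>\<tau>. \<tau> * M) \<longlongrightarrow> 0) (at_right 0)"
      by (auto intro!: tendsto_eq_intros)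
  qed
  from tendsto_add[OF tendsto_const this, of "c 1"]
  have "((\<lambda>\<tau>. c 1 + \<tau> *\<^sub>R tail \<tau>) \<longlongrightarrow> c 1) (at_right 0)"
    by simp
  also have "?this \<longleftrightarrow> ?thesis"
    using split by (intro filterlim_cong refl eventually_at_rightI[of 0 1]) simp_all
  finally show ?thesis .
qed

lemma bounded_bilinear_matrix_vector_mult:
  "bounded_bilinear (\<lambda>(A :: real ^ 'n ^ 'm) x. A *v x)"
  by (auto simp flip: bilinear_conv_bounded_bilinear simp: bilinear_def linear_iff algebra_simps
      scaleR_matrix_vector_assoc)

lemma bounded_bilinear_matrix_matrix_mult:
  "bounded_bilinear (\<lambda>(A :: real ^ 'n ^ 'm) (B :: real ^ 'k ^ 'n). A ** B)"
  by (auto simp flip: bilinear_conv_bounded_bilinear simp: bilinear_def linear_iff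
      matrix_matrix_mult_def vec_eq_iff sum.distrib algebra_simps sum_distrib_left)

lemma matpow_scaleR: "matpow (\<tau> *\<^sub>R A) k = \<tau> ^ k *\<^sub>R matpow A k"
  by (induction k)
    (simp_all add: matpow_def bounded_bilinear.scaleR_left[OF bounded_bilinear_matrix_matrix_mult]
      bounded_bilinear.scaleR_right[OF bounded_bilinear_matrix_matrix_mult] mult.commute)

text \<open>The norm on matrices is only submultiplicative up to a constant \<open>K\<close>; the powers still
  grow at most geometrically, and the factorials win.\<close>

lemma summable_norm_phi1:
  fixes A :: "real ^ 'n ^ 'n"
  shows "summable (\<lambda>k. norm ((1 / fact (k + 1)) *\<^sub>R matpow A k))"
proof -
  obtain K where "K \<ge> 0" and K: "\<And>(B :: real ^ 'n ^ 'n) (C :: real ^ 'n ^ 'n). norm (B ** C) \<le> norm B * norm C * K"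
    using bounded_bilinear.nonneg_bounded[OF bounded_bilinear_matrix_matrix_mult] by metis
  define q where "q = norm A * K"
  have "q \<ge> 0" using \<open>K \<ge> 0\<close> by (simp add: q_def)
  have pow: "norm (matpow A k) \<le> q ^ k * norm (mat 1 :: real ^ 'n ^ 'n)" for k
  proof (induction k)
    case (Suc k)
    have "norm (matpow A (Suc k)) \<le> q * norm (matpow A k)"
      using K[of A "matpow A k"] by (simp add: matpow_def q_def mult_ac)
    also have "\<dots> \<le> q * (q ^ k * norm (mat 1 :: real ^ 'n ^ 'n))"
      using Suc \<open>q \<ge> 0\<close> by (rule mult_left_mono)
    finally show ?case by (simp add: mult_ac)
  qed (simp add: matpow_def)
  have "summable (\<lambda>k. (inverse (fact k) * q ^ k) * norm (mat 1 :: real ^ 'n ^ 'n))"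
    by (intro summable_mult2 summable_exp)
  then show ?thesis
  proof (rule summable_comparison_test')
    fix k :: nat
    have "(1 / fact (k + 1)) * norm (matpow A k) \<le> inverse (fact k) * (q ^ k * norm (mat 1 :: real ^ 'n ^ 'n))"
      using pow[of k] by (intro mult_mono) (auto simp: inverse_eq_divide intro!: divide_left_mono fact_mono)
    then show "norm (norm ((1 / fact (k + 1)) *\<^sub>R matpow A k))
        \<le> inverse (fact k) * q ^ k * norm (mat 1 :: real ^ 'n ^ 'n)"
      by (simp add: mult_ac)
  qed
qed

lemma phi1_difference_quotient_at_0:
  "((\<lambda>\<tau>. (phi1 (\<tau> *\<^sub>R A) - mat 1) /\<^sub>R \<tau>) \<longlongrightarrow> A /\<^sub>R 2) (at_right 0)"
proof -
  have "phi1 (\<tau> *\<^sub>R A) = (\<Sum>k. \<tau> ^ k *\<^sub>R ((1 / fact (k + 1)) *\<^sub>R matpow A k))" for \<tau>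
    by (simp add: phi1_def matpow_scaleR mult.commute)
  with power_series_difference_quotient_at_0[OF summable_norm_phi1[of A]]
  show ?thesis by (simp add: matpow_def inverse_eq_divide)
qed

lemma quadratic_expansion_krylov_op:
  fixes V :: "real ^ 'm ^ 'n"
  shows "quadratic_expansion (krylov_op V H) (V ** transpose V) ((V ** H ** transpose V) /\<^sub>R 2)"
proof -
  interpret l: bounded_bilinear "\<lambda>(A :: real ^ 'm ^ 'n) (B :: real ^ 'm ^ 'm). A ** B"
    by (rule bounded_bilinear_matrix_matrix_mult)
  interpret r: bounded_bilinear "\<lambda>(A :: real ^ 'm ^ 'n) (B :: real ^ 'n ^ 'm). A ** B"
    by (rule bounded_bilinear_matrix_matrix_mult)
  have "((\<lambda>\<tau>. V ** ((phi1 (\<tau> *\<^sub>R H) - mat 1) /\<^sub>R \<tau>) ** transpose V)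
      \<longlongrightarrow> V ** (H /\<^sub>R 2) ** transpose V) (at_right 0)"
    by (rule r.tendsto[OF l.tendsto[OF tendsto_const phi1_difference_quotient_at_0] tendsto_const])
  also have "?this \<longleftrightarrow> ((\<lambda>\<tau>. (krylov_op V H \<tau> - krylov_op V H 0 - \<tau> *\<^sub>R (V ** transpose V)) /\<^sub>R \<tau>\<^sup>2)
      \<longlongrightarrow> V ** (H /\<^sub>R 2) ** transpose V) (at_right 0)"
    by (intro filterlim_cong)
      (auto intro!: eventually_at_rightI[of 0 1] simp: krylov_op_def power2_eq_square
        l.diff_right r.diff_left l.scaleR_right r.scaleR_left scaleR_diff_right field_simps)
  finally show ?thesis
    by (simp add: quadratic_expansion_def l.scaleR_right r.scaleR_left)
qed

text \<open>The exact ETD1 operator is the Krylov operator for the standard basis of the whole space, so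
  it inherits the expansion above.\<close>

lemma etd1_op_eq_krylov_op: "etd1_op L = krylov_op (mat 1) L"
  by (simp add: fun_eq_iff etd1_op_def krylov_op_def transpose_mat)

section \<open>The exact solution\<close>

text \<open>\<open>dFdt\<close> is built from partial derivatives; total differentiability identifies it with
  the directional derivative in the direction \<open>(1, g)\<close> of the flow, the form in which the
  chain rule produces it.\<close>

lemma dFdt_eq_derivative:
  assumes "((\<lambda>(t, x). F t x) has_derivative A) (at (t, x))"
  shows "dFdt L F t x = A (1, rhs L F t x)"
proof -
  interpret A: bounded_linear A
    using assms by (rule has_derivative_bounded_linear)
  have "((\<lambda>(t, x). F t x) \<circ> (\<lambda>s. (s, x)) has_derivative A \<circ> (\<lambda>h. (h, 0))) (at t)"
    by (rule diff_chain_at) (use assms in \<open>auto intro!: derivative_eq_intros\<close>)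
  then have "((\<lambda>s. F s x) has_derivative (\<lambda>h. A (h *\<^sub>R (1, 0)))) (at t)"
    by (simp add: o_def)
  then have "((\<lambda>s. F s x) has_vector_derivative A (1, 0)) (at t)"
    unfolding has_vector_derivative_def A.scaleR .
  moreover have "((\<lambda>(t, x). F t x) \<circ> (\<lambda>y. (t, y)) has_derivative A \<circ> (\<lambda>h. (0, h))) (at x)"
    by (rule diff_chain_at) (use assms in \<open>auto intro!: derivative_eq_intros\<close>)
  then have "(F t has_derivative (\<lambda>h. A (0, h))) (at x)"
    by (simp add: o_def)
  then have "jacobian (F t) (at x) *v y = A (0, y)" for y
    by (metis differentiable_def frechet_derivative_at jacobian_works)
  ultimately show ?thesis
    by (simp add: dFdt_def vector_derivative_at flip: A.add)
qed

text \<open>The curve is arbitrary because it is used twice: with the exact solution (\<open>s = 1\<close>), and with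
  the \<open>j\<close>-th substep as a function of the step length, where time advances at speed \<open>s = j\<close>.\<close>

lemma has_vector_derivative_rhs_along_curve:
  assumes F': "((\<lambda>(t, x). F t x) has_derivative A) (at (tn, x 0))"
    and x': "(x has_vector_derivative v) (at_right 0)"
  shows "((\<lambda>h. rhs L F (tn + s * h) (x h)) has_vector_derivative L *v v + A (s, v)) (at_right 0)"
proof -
  interpret A: bounded_linear A
    using F' by (rule has_derivative_bounded_linear)
  have "((\<lambda>h. (tn + s * h, x h)) has_derivative (\<lambda>h. (s * h, h *\<^sub>R v))) (at_right 0)"
    using x' unfolding has_vector_derivative_def by (auto intro!: derivative_eq_intros)
  then have "((\<lambda>(t, x). F t x) \<circ> (\<lambda>h. (tn + s * h, x h)) has_derivative A \<circ> (\<lambda>h. (s * h, h *\<^sub>R v))) (at_right 0)"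
    by (rule diff_chain_within) (use F' in \<open>simp add: has_derivative_at_withinI\<close>)
  then have "((\<lambda>h. F (tn + s * h) (x h)) has_derivative (\<lambda>h. A (h *\<^sub>R (s, v)))) (at_right 0)"
    by (simp add: o_def mult.commute)
  then have "((\<lambda>h. F (tn + s * h) (x h)) has_vector_derivative A (s, v)) (at_right 0)"
    unfolding has_vector_derivative_def A.scaleR .
  moreover have "((\<lambda>h. L *v x h) has_vector_derivative L *v v) (at_right 0)"
    using bounded_linear.has_vector_derivative[OF matrix_vector_mul_bounded_linear x'] .
  ultimately show ?thesis
    unfolding rhs_def by (intro has_vector_derivative_add)
qed

lemma quadratic_expansion_solution:
  assumes "T > 0"
    and u': "\<And>t. t \<in> {tn..tn + T} \<Longrightarrow>
           (u has_vector_derivative rhs L F t (u t)) (at t within {tn..tn + T})"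
    and F': "(\<lambda>(t, x). F t x) differentiable (at (tn, u tn))"
  defines "g \<equiv> rhs L F tn (u tn)"
  shows "quadratic_expansion (\<lambda>h. u (tn + h)) g ((L *v g + dFdt L F tn (u tn)) /\<^sub>R 2)"
proof -
  obtain A where A: "((\<lambda>(t, x). F t x) has_derivative A) (at (tn, u tn))"
    using F' by (auto simp: differentiable_def)
  have x': "((\<lambda>h. u (tn + h)) has_vector_derivative rhs L F (tn + h) (u (tn + h))) (at h within {0..T})"
    if "h \<in> {0..T}" for h
  proof -
    have "(u has_vector_derivative rhs L F (tn + h) (u (tn + h))) (at (tn + h) within (+) tn ` {0..T})"
      using u'[of "tn + h"] that by (simp add: add.commute)
    moreover have "((\<lambda>h. tn + h) has_vector_derivative 1) (at h within {0..T})"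
      by (auto intro!: derivative_eq_intros)
    ultimately show ?thesis
      using vector_diff_chain_within[of "(+) tn" 1 h "{0..T}" u] by (simp add: o_def)
  qed
  have "((\<lambda>h. u (tn + h)) has_vector_derivative g) (at_right 0)"
    using x'[of 0] \<open>T > 0\<close> by (simp add: at_within_Icc_at_right g_def)
  from has_vector_derivative_rhs_along_curve[where s = 1, OF _ this] A
  have "((\<lambda>h. rhs L F (tn + h) (u (tn + h))) has_vector_derivative L *v g + A (1, g)) (at_right 0)"
    by simp
  from quadratic_expansion_of_primitive[OF \<open>T > 0\<close> x' this] show ?thesis
    by (simp add: g_def dFdt_eq_derivative[OF A])
qed

section \<open>The recycling scheme and its local error\<close>

lemma quadratic_expansion_krylov_op_mult_vector:
  fixes V :: "real ^ 'm ^ 'n"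
  assumes "(r has_vector_derivative r') (at_right 0)"
  shows "quadratic_expansion (\<lambda>h. krylov_op V H h *v r h) ((V ** transpose V) *v r 0)
     (((V ** H ** transpose V) *v r 0) /\<^sub>R 2 + (V ** transpose V) *v r')"
proof -
  have "quadratic_expansion (\<lambda>h. krylov_op V H h *v r h) ((V ** transpose V) *v r 0)
     (((V ** H ** transpose V) /\<^sub>R 2) *v r 0 + (V ** transpose V) *v r')"
    by (rule quadratic_expansion_bilinear[OF bounded_bilinear_matrix_vector_mult
          quadratic_expansion_krylov_op _ assms]) (simp add: krylov_op_def)
  then show ?thesis by (simp add: scaleR_matrix_vector_assoc)
qed

text \<open>Up to \<open>o(\<delta>)\<close>, the right-hand side at substep \<open>j\<close> is \<open>g + j \<delta> (L g + D)\<close>. Applying the Krylov operator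
  adds \<open>\<delta> g + \<delta>\<^sup>2 ((j + 1/2) L g + j P D) + o(\<delta>\<^sup>2)\<close>; the closed form comes from summing over \<open>j\<close>. For the
  \<open>L g\<close> part the sum is that of the exact step of length \<open>j \<delta>\<close>, so to this order substepping does not
  disturb the linear part, whereas \<open>P D\<close> picks up the triangular number \<open>j (j - 1) / 2\<close>.\<close>

lemma quadratic_expansion_recycling_substep:
  fixes V :: "real ^ 'm ^ 'n" and L :: "real ^ 'n ^ 'n"
  assumes F': "(\<lambda>(t, x). F t x) differentiable (at (tn, un))"
  defines "g \<equiv> rhs L F tn un" and "P \<equiv> V ** transpose V"
  assumes Pg: "P *v g = g" and PLg: "P *v (L *v g) = L *v g"
    and VHVg: "(V ** H ** transpose V) *v g = L *v g"
  shows "quadratic_expansion (\<lambda>\<delta>. recycling_substep L F V H tn un \<delta> j) (real j *\<^sub>R g)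
     (((real j)\<^sup>2 / 2) *\<^sub>R (L *v g) + (real j * (real j - 1) / 2) *\<^sub>R (P *v dFdt L F tn un))"
proof (induction j)
  case 0
  show ?case by (simp add: quadratic_expansion_def)
next
  case (Suc j)
  let ?x = "\<lambda>\<delta>. recycling_substep L F V H tn un \<delta> j"
  let ?D = "dFdt L F tn un"
  obtain A where A: "((\<lambda>(t, x). F t x) has_derivative A) (at (tn, un))"
    using F' by (auto simp: differentiable_def)
  interpret A: bounded_linear A
    using A by (rule has_derivative_bounded_linear)
  have x0: "?x 0 = un"
    by (induction j) (simp_all add: krylov_op_def)
  have "((\<lambda>\<delta>. rhs L F (tn + real j * \<delta>) (?x \<delta>)) has_vector_derivative
      L *v (real j *\<^sub>R g) + A (real j, real j *\<^sub>R g)) (at_right 0)"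
    by (rule has_vector_derivative_rhs_along_curve[OF _ quadratic_expansion_imp_derivative[OF Suc.IH]])
      (simp add: A x0)
  also have "L *v (real j *\<^sub>R g) + A (real j, real j *\<^sub>R g) = real j *\<^sub>R (L *v g + ?D)"
    using A.scaleR[of "real j" "(1, g)"]
    by (simp add: dFdt_eq_derivative[OF A] g_def matrix_vector_mult_scaleR scaleR_add_right)
  finally have rhs': "((\<lambda>\<delta>. rhs L F (tn + real j * \<delta>) (?x \<delta>)) has_vector_derivative
      real j *\<^sub>R (L *v g + ?D)) (at_right 0)" .
  from quadratic_expansion_add[OF Suc.IH quadratic_expansion_krylov_op_mult_vector[OF rhs', of V H]]
  have "quadratic_expansion (\<lambda>\<delta>. recycling_substep L F V H tn un \<delta> (Suc j)) (real j *\<^sub>R g + g)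
     (((real j)\<^sup>2 / 2) *\<^sub>R (L *v g) + (real j * (real j - 1) / 2) *\<^sub>R (P *v ?D)
       + ((L *v g) /\<^sub>R 2 + real j *\<^sub>R (L *v g + P *v ?D)))"
    by (simp add: x0 Pg VHVg PLg matrix_vector_mult_scaleR matrix_vector_right_distrib
        flip: g_def P_def)
  also have "real j *\<^sub>R g + g = real (Suc j) *\<^sub>R g"
    by (simp add: algebra_simps)
  also have "((real j)\<^sup>2 / 2) *\<^sub>R (L *v g) + (real j * (real j - 1) / 2) *\<^sub>R (P *v ?D)
       + ((L *v g) /\<^sub>R 2 + real j *\<^sub>R (L *v g + P *v ?D)) =
     ((real j)\<^sup>2 / 2 + 1 / 2 + real j) *\<^sub>R (L *v g) + (real j * (real j - 1) / 2 + real j) *\<^sub>R (P *v ?D)"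
    by (simp add: scaleR_add_left scaleR_add_right inverse_eq_divide)
  also have "(real j)\<^sup>2 / 2 + 1 / 2 + real j = (real (Suc j))\<^sup>2 / 2"
    by (simp add: power2_eq_square field_simps)
  also have "real j * (real j - 1) / 2 + real j = real (Suc j) * (real (Suc j) - 1) / 2"
    by (simp add: field_simps)
  finally show ?case .
qed

text \<open>Both operators have the same linear term on \<open>g\<close>, and a difference of \<open>o(\<tau>\<^sup>2)\<close> leaves no room for
  different quadratic ones. The error \<open>e\<close> enters only through its order \<open>\<tau>\<^sup>2\<close>.\<close>

lemma krylov_coefficients_of_small_error:
  fixes V :: "real ^ 'm ^ 'n"
  assumes Pg: "(V ** transpose V) *v g = g"
    and e: "quadratic_expansion e 0 c" and "e 0 = 0"
    and small: "(\<lambda>\<tau>. norm (krylov_op V H \<tau> *v g - etd1_op L \<tau> *v g)) \<in> o[at_right 0](\<lambda>\<tau>. norm (e \<tau>))"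
  shows "(V ** H ** transpose V) *v g = L *v g"
proof -
  let ?d = "\<lambda>\<tau>. krylov_op V H \<tau> *v g - etd1_op L \<tau> *v g"
  have "((\<lambda>\<tau>. e \<tau> /\<^sub>R \<tau>\<^sup>2) \<longlongrightarrow> c) (at_right 0)"
    using e \<open>e 0 = 0\<close> by (simp add: quadratic_expansion_def)
  then have "((\<lambda>\<tau>. norm (e \<tau>) / \<tau>\<^sup>2) \<longlongrightarrow> norm c) (at_right 0)"
    using tendsto_norm by (fastforce simp: divide_inverse mult.commute)
  then have "(\<lambda>\<tau>. norm (e \<tau>)) \<in> O[at_right 0](\<lambda>\<tau>. \<tau>\<^sup>2)"
    by (rule bigoI_tendsto) (auto intro!: eventually_at_rightI[of 0 1])
  with small have "(\<lambda>\<tau>. norm (?d \<tau>)) \<in> o[at_right 0](\<lambda>\<tau>. \<tau>\<^sup>2)"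
    by (rule landau_o.small_big_trans)
  then have "((\<lambda>\<tau>. norm (?d \<tau>) / \<tau>\<^sup>2) \<longlongrightarrow> 0) (at_right 0)"
    by (rule smalloD_tendsto)
  then have d0: "((\<lambda>\<tau>. ?d \<tau> /\<^sub>R \<tau>\<^sup>2) \<longlongrightarrow> 0) (at_right 0)"
    by (subst tendsto_norm_zero_iff[symmetric]) (simp add: divide_inverse mult.commute)
  have "quadratic_expansion ?d 0
      ((((V ** H ** transpose V) *v g) - L *v g) /\<^sub>R 2)"
    using quadratic_expansion_diff[OF
        quadratic_expansion_krylov_op_mult_vector[where r = "\<lambda>_. g", OF has_vector_derivative_const, of V H]
        quadratic_expansion_krylov_op_mult_vector[where r = "\<lambda>_. g", OF has_vector_derivative_const, of "mat 1" L]]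
    by (simp add: etd1_op_eq_krylov_op transpose_mat scaleR_diff_right Pg)
  then have "((\<lambda>\<tau>. ?d \<tau> /\<^sub>R \<tau>\<^sup>2) \<longlongrightarrow> ((V ** H ** transpose V) *v g - L *v g) /\<^sub>R 2) (at_right 0)"
    by (simp add: quadratic_expansion_def etd1_op_def krylov_op_def)
  from tendsto_unique[OF _ this d0] show ?thesis
    by simp
qed

text \<open>\<open>V V\<^sup>T\<close> fixes the columns of \<open>V\<close>, as these are orthonormal, and \<open>g\<close> is in their span as the first
  Krylov vector.\<close>

lemma arnoldi_projection:
  fixes V :: "real ^ ('m::{finite,linorder}) ^ 'n"
  assumes "arnoldi L g V H"
  shows "(V ** transpose V) *v g = g"
proof -
  let ?fixed = "{x. (V ** transpose V) *v x = x}"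
  have "columns V \<subseteq> ?fixed"
  proof
    fix x assume "x \<in> columns V"
    then obtain j where "x = V *v axis j 1"
      by (auto simp: columns_def matrix_vector_mult_basis)
    moreover have "(V ** transpose V) ** V = V"
      using assms by (simp add: arnoldi_def flip: matrix_mul_assoc)
    ultimately show "x \<in> ?fixed"
      by (simp add: matrix_vector_mul_assoc)
  qed
  moreover have "subspace ?fixed"
    by (auto simp: subspace_def matrix_vector_right_distrib matrix_vector_mult_scaleR)
  ultimately have "span (columns V) \<subseteq> ?fixed"
    by (rule span_minimal)
  moreover have "matpow L 0 *v g \<in> krylov L g CARD('m)"
    unfolding krylov_def by (intro span_base imageI) simp
  then have "g \<in> span (columns V)"
    using assms by (simp add: arnoldi_def matpow_def)
  ultimately show ?thesis by auto
qed

text \<open>The \<open>g\<close> and \<open>L g\<close> terms of the exact solution and of the scheme cancel, which leaves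
  \<open>D / 2\<close> from the solution against \<open>S (S - 1) / (2 S\<^sup>2)\<close> times \<open>P D\<close> from the substeps.\<close>

lemma quadratic_expansion_recycling_local_error:
  fixes V :: "real ^ ('m::{finite,linorder}) ^ 'n"
  assumes "T > 0"
    and u': "\<And>t. t \<in> {tn..tn + T} \<Longrightarrow>
           (u has_vector_derivative rhs L F t (u t)) (at t within {tn..tn + T})"
    and F': "(\<lambda>(t, x). F t x) differentiable (at (tn, u tn))"
    and arnoldi: "arnoldi L (rhs L F tn (u tn)) V H"
    and small: "(\<lambda>\<tau>. norm (krylov_op V H \<tau> *v rhs L F tn (u tn) - etd1_op L \<tau> *v rhs L F tn (u tn)))
           \<in> o[at_right 0](\<lambda>\<tau>. norm (etd1_local_error L F u tn \<tau>))"
    and "S \<ge> 1"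
  shows "quadratic_expansion (recycling_local_error L F V H u tn S) 0
    ((dFdt L F tn (u tn) - ((real S - 1) / real S) *\<^sub>R ((V ** transpose V) *v dFdt L F tn (u tn))) /\<^sub>R 2)"
proof -
  define g where "g = rhs L F tn (u tn)"
  define D where "D = dFdt L F tn (u tn)"
  define P where "P = V ** transpose V"
  have Pg: "P *v g = g"
    using arnoldi_projection[OF arnoldi] by (simp add: P_def g_def)
  have sol: "quadratic_expansion (\<lambda>h. u (tn + h)) g ((L *v g + D) /\<^sub>R 2)"
    using quadratic_expansion_solution[OF \<open>T > 0\<close> u' F'] by (simp add: g_def D_def)
  have etd1: "quadratic_expansion (\<lambda>h. u tn + etd1_op L h *v g) g ((L *v g) /\<^sub>R 2)"
    using quadratic_expansion_krylov_op_mult_vector[where r = "\<lambda>_. g", OF has_vector_derivative_const, of "mat 1" L]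
    by (simp add: etd1_op_eq_krylov_op transpose_mat quadratic_expansion_def)
  have "quadratic_expansion (etd1_local_error L F u tn) 0 (D /\<^sub>R 2)"
    using quadratic_expansion_diff[OF sol etd1]
    by (simp add: etd1_local_error_def[abs_def] scaleR_add_right flip: g_def)
  moreover have "etd1_local_error L F u tn 0 = 0"
    by (simp add: etd1_local_error_def etd1_op_def)
  ultimately have VHVg: "(V ** H ** transpose V) *v g = L *v g"
    using small Pg by (intro krylov_coefficients_of_small_error) (auto simp: g_def P_def)
  \<comment> \<open>\<open>L g\<close> is now known to be in the range of \<open>V\<close>, so the projector fixes it.\<close>
  have "P ** (V ** H ** transpose V) = V ** (transpose V ** V) ** H ** transpose V"
    by (simp add: P_def matrix_mul_assoc)
  then have "P *v ((V ** H ** transpose V) *v g) = (V ** H ** transpose V) *v g"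
    using arnoldi by (simp add: arnoldi_def matrix_vector_mul_assoc)
  then have PLg: "P *v (L *v g) = L *v g"
    by (simp add: VHVg)
  have "quadratic_expansion (\<lambda>\<delta>. recycling_substep L F V H tn (u tn) \<delta> S) (real S *\<^sub>R g)
     (((real S)\<^sup>2 / 2) *\<^sub>R (L *v g) + (real S * (real S - 1) / 2) *\<^sub>R (P *v D))"
    using quadratic_expansion_recycling_substep[where V = V and H = H and j = S, OF F'] Pg PLg VHVg
    by (simp add: g_def P_def D_def)
  from quadratic_expansion_rescale[OF this, of "1 / real S"] \<open>S \<ge> 1\<close>
  have "quadratic_expansion (\<lambda>h. recycling_substep L F V H tn (u tn) (h / real S) S) g
     ((1 / real S)\<^sup>2 *\<^sub>R (((real S)\<^sup>2 / 2) *\<^sub>R (L *v g) + (real S * (real S - 1) / 2) *\<^sub>R (P *v D)))"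
    by simp
  also have "(1 / real S)\<^sup>2 *\<^sub>R (((real S)\<^sup>2 / 2) *\<^sub>R (L *v g) + (real S * (real S - 1) / 2) *\<^sub>R (P *v D)) =
     (L *v g + ((real S - 1) / real S) *\<^sub>R (P *v D)) /\<^sub>R 2"
    using \<open>S \<ge> 1\<close> by (simp add: scaleR_add_right power2_eq_square field_simps)
  finally have substeps: "quadratic_expansion (\<lambda>h. recycling_substep L F V H tn (u tn) (h / real S) S) g
     ((L *v g + ((real S - 1) / real S) *\<^sub>R (P *v D)) /\<^sub>R 2)" .
  have "quadratic_expansion (recycling_local_error L F V H u tn S) (g - g)
      ((L *v g + D) /\<^sub>R 2 - (L *v g + ((real S - 1) / real S) *\<^sub>R (P *v D)) /\<^sub>R 2)"
    using quadratic_expansion_diff[OF sol substeps] by (simp only: recycling_local_error_def[abs_def])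
  then show ?thesis
    by (simp add: scaleR_add_right scaleR_diff_right D_def P_def)
qed

section \<open>Comparison of the leading terms\<close>

text \<open>\<open>D - c P D = (D - P D) + (1 - c) P D\<close> is an orthogonal decomposition, and only its
  second component depends on \<open>c\<close>.\<close>

lemma norm_diff_scaled_projection_less:
  fixes D :: "real ^ 'n"
  assumes orth: "transpose V ** V = mat 1"
  defines "P \<equiv> V ** transpose V"
  assumes "P *v D \<noteq> 0" and "a < b" and "b < 1"
  shows "norm (D - b *\<^sub>R (P *v D)) < norm (D - a *\<^sub>R (P *v D))"
proof -
  have PP: "P ** P = P"
    using orth by (metis P_def matrix_mul_assoc matrix_mul_lid)
  have "transpose P = P"
    by (simp add: P_def matrix_transpose_mul)
  then have "inner (P *v D) (D - P *v D) = 0"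
    using PP by (metis (no_types) dot_lmul_matrix matrix_vector_mult_diff_distrib matrix_vector_mul_assoc
      diff_self inner_zero_right transpose_matrix_vector)
  then have norm_sq: "(norm (D - c *\<^sub>R (P *v D)))\<^sup>2 = (norm (D - P *v D))\<^sup>2 + (1 - c)\<^sup>2 * (norm (P *v D))\<^sup>2" for c
    unfolding power2_norm_eq_inner by (simp add: inner_diff inner_commute power2_eq_square algebra_simps)
  have "(1 - b)\<^sup>2 < (1 - a)\<^sup>2"
    using \<open>a < b\<close> \<open>b < 1\<close> by (intro power_strict_mono) auto
  then have "(norm (D - b *\<^sub>R (P *v D)))\<^sup>2 < (norm (D - a *\<^sub>R (P *v D)))\<^sup>2"
    using \<open>P *v D \<noteq> 0\<close> by (simp add: norm_sq)
  then show ?thesis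
    by (rule power2_less_imp_less) simp
qed


theorem lemma3p8:
  fixes L :: "real ^ 'n ^ 'n"
    and F :: "real \<Rightarrow> real ^ 'n \<Rightarrow> real ^ 'n"
    and u :: "real \<Rightarrow> real ^ 'n"
    and V :: "real ^ ('m::{finite,linorder}) ^ 'n"
    and H :: "real ^ ('m::{finite,linorder}) ^ ('m::{finite,linorder})"
    and tn T :: real
    and S1 S2 :: nat
  assumes "T > 0"
    and "\<And>t. t \<in> {tn..tn + T} \<Longrightarrow>
           (u has_vector_derivative (L *v u t + F t (u t))) (at t within {tn..tn + T})"
    and "(\<lambda>(t, x). F t x) differentiable (at (tn, u tn))"
    and "arnoldi L (rhs L F tn (u tn)) V H"
    and "(\<lambda>\<tau>. norm (krylov_op V H \<tau> *v rhs L F tn (u tn) - etd1_op L \<tau> *v rhs L F tn (u tn)))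
           \<in> o[at_right 0](\<lambda>\<tau>. norm (etd1_local_error L F u tn \<tau>))"
    and "dFdt L F tn (u tn) \<noteq> 0"
    and "(V ** transpose V) *v dFdt L F tn (u tn) \<noteq> 0"
    and "1 \<le> S1" and "S1 < S2"
  shows "\<forall>\<^sub>F \<Delta>t in at_right 0.
           norm (recycling_local_error L F V H u tn S2 \<Delta>t)
             < norm (recycling_local_error L F V H u tn S1 \<Delta>t)"
proof -
  let ?D = "dFdt L F tn (u tn)" and ?P = "V ** transpose V"
  let ?E = "\<lambda>S. recycling_local_error L F V H u tn S"
  let ?c = "\<lambda>S. (?D - ((real S - 1) / real S) *\<^sub>R (?P *v ?D)) /\<^sub>R 2"
  have expansion: "quadratic_expansion (?E S) 0 (?c S)" if "S \<ge> 1" for S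
    using assms(1-5) that
    by (intro quadratic_expansion_recycling_local_error) (auto simp: rhs_def)
  have at_0: "?E S 0 = 0" for S
  proof -
    have "recycling_substep L F V H tn (u tn) 0 j = u tn" for j
      by (induction j) (simp_all add: krylov_op_def)
    then show ?thesis by (simp add: recycling_local_error_def)
  qed
  have "norm (?D - ((real S2 - 1) / real S2) *\<^sub>R (?P *v ?D)) < norm (?D - ((real S1 - 1) / real S1) *\<^sub>R (?P *v ?D))"
  proof (rule norm_diff_scaled_projection_less)
    show "transpose V ** V = mat 1"
      using assms(4) by (simp add: arnoldi_def)
    show "(real S1 - 1) / real S1 < (real S2 - 1) / real S2" "(real S2 - 1) / real S2 < 1"
      using assms(8,9) by (auto simp: field_simps)
  qed fact
  then have "norm (?c S2) < norm (?c S1)"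
    by simp
  with expansion at_0 assms(8,9) show ?thesis
    by (intro norm_less_of_quadratic_expansion[of _ "?c S2" _ "?c S1"]) auto
qed

end
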